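(* Suppose that: (i) $|f_j(u)-f_j(v)|\le L_j^f|u-v|$ and $|g_j(u)-g_j(v)|\le L_j^g|u-v|$ for all $u,v\in\mathbb R$, $j=1,\dots,m$, with constants $L_j^f,L_j^g>0$; (ii) $|I_{ik}(u)-I_{ik}(v)|\le \ell|u-v|$ for all $u,v\in\mathbb R$, $i=1,\dots,m$, $k\in\mathbb N$, with a constant $\ell>0$; (iii) $\big[(k_1+2k_2)\overline\theta+\ell p\big](1+\ell)^p e^{k_1\overline\theta}<1$; (iv) $k_2\overline\theta+(k_1\overline\theta+\ell p)(1+k_2\overline\theta)(1+\ell)^p e^{k_1\overline\theta}<1$; (v) $\gamma-\mu-\lambda k_2-\dfrac{\ln(1+\ell)}{\underline\tau}>0$; (vi) there are a real number $\omega>0$ and positive integers $q,p_1$ such that $\tau_{k+q}=\tau_k+\omega$, $\theta_{k+p_1}=\theta_k+\omega$ and $I_{i,k+q}=I_{ik}$ for all $k\in\mathbb N$ and $i=1,\dots,m$, and $[0,\omega]$ contains exactly $q$ points of the sequence $\tau$; (vii) $\mathcal R\big(\omega(\mu+\lambda k_2)+\ell q\big)<1$, where $\mathcal R=\dfrac{1}{1-e^{-\gamma\omega}}$. Let $z^*$ denote the $\omega$-periodic solution of the system $$x_i'(t)=-a_ix_i(t)+\sum_{j=1}^m b_{ij}f_j(x_j(t))+\sum_{j=1}^m c_{ij}g_j(x_j(\beta(t)))+d_i,\quad t\ne\tau_k,$$ $$\Delta x_i|_{t=\tau_k}=I_{ik}(x_i(\tau_k^-)),\quad i=1,\dots,m,\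 k\in\mathbb N.$$ Then $z^*$ is globally asymptotically stable.
   Context: $\mathbb N=\{0,1,2,\dots\}$, $\mathbb R^+=[0,\infty)$, $\|u\|=\sum_{i=1}^m|u_i|$ on $\mathbb R^m$. The sequences $\theta=\{\theta_k\}_{k\in\mathbb N}$ (with $\theta_0=0$) and $\tau=\{\tau_k\}_{k\in\mathbb N}$ are real, strictly increasing, tend to $\infty$, and are disjoint: $\tau\cap\theta=\emptyset$. There are positive numbers $\overline\theta,\underline\tau$ with $\theta_{k+1}-\theta_k\le\overline\theta$ and $\underline\tau\le\tau_{k+1}-\tau_k$ for all $k\in\mathbb N$. The integer $p$ is the maximum over $k\in\mathbb N$ of the number of points of $\tau$ in $(\theta_k,\theta_{k+1})$, assumed finite. The function $\beta:\mathbb R^+\to\mathbb R^+$ is defined by $\beta(t)=\theta_k$ for $\theta_k\le t<\theta_{k+1}$. The numbers $a_i>0$ and $b_{ij},c_{ij},d_i\in\mathbb R$ ($i,j=1,\dots,m$) are constants; $f_j,g_j,I_{ik}:\mathbb R\to\mathbb R$. Put $$k_1=\max_{1\le i\le m}\Big(a_i+L_i^f\sum_{j=1}^m|b_{ji}|\Big),\quad k_2=\max_{1\le i\le m}\Big(L_i^g\sum_{j=1}^m|c_{ji}|\Big),\quad \mu=\max_{1\le i\le m}\Big(L_i^f\sum_{j=1}^m|b_{ji}|\Big),\quad \gamma=\min_{1\le i\le m}a_i,$$ $$\lambda=\Big(1-\big(k_2\overline\theta+(k_1\overline\theta+\ell p)(1+k_2\overline\theta)(1+\ell)^p e^{k_1\overline\theta}\big)\Big)^{-1}.$$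 $\Delta x_i|_{t=\tau_k}=x_i(\tau_k)-x_i(\tau_k^-)$, where $x_i(\tau_k^-)$ is the left limit. A solution is a right-continuous function $x$ into $\mathbb R^m$, continuous except possibly at points of $\tau$ where it has discontinuities of the first kind, whose derivative $x'$ is right-continuous and continuous except possibly at points of $\tau\cup\theta$ where it has discontinuities of the first kind (the derivative at such points being the right derivative), and which satisfies the differential equation and the jump conditions. A solution with initial condition at $t_0\ge0$ is understood to be defined on $[\beta(t_0),\infty)$, so that $x(\beta(t))$ makes sense for $t\ge t_0$. A solution $x:\mathbb R^+\to\mathbb R^m$ is $\omega$-periodic if $x(t+\omega)=x(t)$ for all $t\ge0$. Under the hypotheses of the claim the system has a unique $\omega$-periodic solution, and this is the solution $z^*$ referred to. Globally asymptotically stable means: for every $t_0\ge0$, $z^*$ is Lyapunov stable (for every $\varepsilon>0$ there is $\delta>0$ such that every solution $z$ with $\|z(t_0)-z^*(t_0)\|<\delta$ satisfies $\|z(t)-z^*(t)\|<\varepsilon$ for all $t\ge t_0$), and every solution $z$ satisfies $\|z(t)-z^*(t)\|\to0$ as $t\to\infty$. *)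

theory Defs
  imports "HOL-Analysis.Analysis"
begin

definition norm1 :: "real ^ 'm \<Rightarrow> real" where
  "norm1 u = (\<Sum>i\<in>UNIV. \<bar>u $ i\<bar>)"

definition piecewise_arg :: "(nat \<Rightarrow> real) \<Rightarrow> real \<Rightarrow> real" where
  "piecewise_arg \<theta> t = \<theta> (THE k. \<theta> k \<le> t \<and> t < \<theta> (Suc k))"

definition network_rhs ::
  "('m::finite \<Rightarrow> real) \<Rightarrow> ('m \<Rightarrow> 'm \<Rightarrow> real) \<Rightarrow> ('m \<Rightarrow> 'm \<Rightarrow> real) \<Rightarrow> ('m \<Rightarrow> real) \<Rightarrow>
   ('m \<Rightarrow> real \<Rightarrow> real) \<Rightarrow> ('m \<Rightarrow> real \<Rightarrow> real) \<Rightarrow> real ^ 'm \<Rightarrow> real ^ 'm \<Rightarrow> real ^ 'm" where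
  "network_rhs a b c d f g u v =
     (\<chi> i. - a i * u $ i + (\<Sum>j\<in>UNIV. b i j * f j (u $ j))
              + (\<Sum>j\<in>UNIV. c i j * g j (v $ j)) + d i)"

text \<open>
  The solutions with initial condition at \<open>t0\<close>. They live on the half-line from
  \<open>s = piecewise_arg \<theta> t0\<close>, and it is on this whole half-line (not only from \<open>t0\<close> on) that
  the equation and the jump conditions hold; the values of \<open>x\<close> before \<open>s\<close> are irrelevant.
  The function \<open>x'\<close> is the derivative, understood as the right derivative at \<open>s\<close> and at the points
  of \<open>\<tau>\<close> and \<open>\<theta>\<close>. A discontinuity of the first kind is one where both one-sided limits
  exist; the right-hand one is covered by right-continuity. Since \<open>s\<close> is a point of \<open>\<theta>\<close>, it is
  never a point of \<open>\<tau>\<close>.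
\<close>

definition network_solution ::
  "('m::finite \<Rightarrow> real) \<Rightarrow> ('m \<Rightarrow> 'm \<Rightarrow> real) \<Rightarrow> ('m \<Rightarrow> 'm \<Rightarrow> real) \<Rightarrow> ('m \<Rightarrow> real) \<Rightarrow>
   ('m \<Rightarrow> real \<Rightarrow> real) \<Rightarrow> ('m \<Rightarrow> real \<Rightarrow> real) \<Rightarrow> ('m \<Rightarrow> nat \<Rightarrow> real \<Rightarrow> real) \<Rightarrow>
   (nat \<Rightarrow> real) \<Rightarrow> (nat \<Rightarrow> real) \<Rightarrow> real \<Rightarrow> (real \<Rightarrow> real ^ 'm) \<Rightarrow> bool" where
  "network_solution a b c d f g I \<tau> \<theta> t0 x \<longleftrightarrow>
     (let s = piecewise_arg \<theta> t0 in
       (\<forall>t\<ge>s. continuous (at_right t) x) \<and>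
       (\<forall>t>s. t \<notin> range \<tau> \<longrightarrow> isCont x t) \<and>
       (\<exists>x'.
         (\<forall>t\<ge>s. (x has_vector_derivative x' t) (at_right t)) \<and>
         (\<forall>t>s. t \<notin> range \<tau> \<union> range \<theta> \<longrightarrow> (x has_vector_derivative x' t) (at t)) \<and>
         (\<forall>t\<ge>s. continuous (at_right t) x') \<and>
         (\<forall>t>s. t \<notin> range \<tau> \<union> range \<theta> \<longrightarrow> isCont x' t) \<and>
         (\<forall>t>s. t \<in> range \<tau> \<union> range \<theta> \<longrightarrow> (\<exists>l. (x' \<longlongrightarrow> l) (at_left t))) \<and>
         (\<forall>t\<ge>s. t \<notin> range \<tau> \<longrightarrow>
            x' t = network_rhs a b c d f g (x t) (x (piecewise_arg \<theta> t)))) \<and>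
       (\<forall>k. \<tau> k > s \<longrightarrow>
         (\<exists>l. (x \<longlongrightarrow> l) (at_left (\<tau> k)) \<and> (\<forall>i. x (\<tau> k) $ i - l $ i = I i k (l $ i)))))"

definition periodic_from_0 :: "real \<Rightarrow> (real \<Rightarrow> 'a) \<Rightarrow> bool" where
  "periodic_from_0 \<omega> x \<longleftrightarrow> (\<forall>t\<ge>0. x (t + \<omega>) = x t)"

text \<open>\<open>sol t0\<close> is the set of the solutions with initial condition at \<open>t0\<close>, as a predicate.\<close>

definition globally_asymptotically_stable ::
  "(real \<Rightarrow> (real \<Rightarrow> real ^ 'm) \<Rightarrow> bool) \<Rightarrow> (real \<Rightarrow> real ^ 'm) \<Rightarrow> bool" where
  "globally_asymptotically_stable sol zs \<longleftrightarrow>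
     (\<forall>t0\<ge>0.
       (\<forall>\<epsilon>>0. \<exists>\<delta>>0. \<forall>z. sol t0 z \<and> norm1 (z t0 - zs t0) < \<delta> \<longrightarrow>
          (\<forall>t\<ge>t0. norm1 (z t - zs t) < \<epsilon>)) \<and>
       (\<forall>z. sol t0 z \<longrightarrow> ((\<lambda>t. norm1 (z t - zs t)) \<longlongrightarrow> 0) at_top))"

end

theory Submission
  imports Defs
begin

text \<open>
  Let \<open>y = z - z*\<close> be the difference of a solution and the periodic one, and \<open>\<parallel>\<cdot>\<parallel>\<close> the
  1-norm. By the Lipschitz conditions \<open>y\<close> satisfies a linear differential inequality whose only delayed term is bounded by
  \<open>k2 \<parallel>y(\<beta>(t))\<parallel>\<close>, and each impulse multiplies \<open>\<parallel>y\<parallel>\<close> by at most \<open>1 + l\<close>. Two observations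
  give exponential decay.

  First, the delayed value is controlled by the present one: \<open>\<parallel>y(\<beta>(t))\<parallel> \<le> \<lambda> \<parallel>y(t)\<parallel>\<close>
  (\<open>norm1_at_delayed_argument_le\<close>). On one interval \<open>[\<theta>\<^sub>k, \<theta>\<^sub>k\<^sub>+\<^sub>1)\<close> the
  solution can grow only by a factor known from Gronwall's inequality, hence it can move away from
  \<open>y(\<theta>\<^sub>k)\<close> by at most a multiple of \<open>\<parallel>y(\<theta>\<^sub>k)\<parallel>\<close>; the smallness condition that makes
  \<open>\<lambda>\<close> finite and positive says that this multiple is less than 1.

  Second, after this replacement no delay is left: \<open>\<parallel>y\<parallel>\<close> decreases between impulses at rate
  \<open>\<gamma> - \<mu> - \<lambda> k2\<close> (\<open>damped_impulsive_decay\<close>). The impulses, being at least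
  \<open>\<tau>_inf\<close> apart, cost at most a constant factor and \<open>ln (1 + l) / \<tau>_inf\<close> in the exponent.
  The remaining rate is positive, so \<open>\<parallel>y(t)\<parallel>\<close> is bounded by \<open>\<parallel>y(t0)\<parallel>\<close> times a decaying
  exponential, which yields both stability and attraction
  (\<open>globally_asymptotically_stable_if_exponential\<close>).

  Both estimates are instances of one Gronwall inequality with jumps, \<open>impulsive_gronwall\<close>. It is
  formulated with one-sided growth rates, since \<open>\<parallel>y\<parallel>\<close> need not be differentiable where a component
  of \<open>y\<close> vanishes; this also avoids any integral.
\<close>

section \<open>Induction along a real interval\<close>

text \<open>
  A property that spreads a little to the right of each point, and passes to the
  supremum of an interval on which it holds, cannot stop before \<open>B\<close>: look at the infimum of the
  points where it fails. A jump of a function only concerns the step at its left limit, so this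
  treats continuous growth and impulses in a single argument.
\<close>

lemma real_interval_induct [consumes 1, case_names base right left]:
  fixes A B :: real
  assumes "A \<le> B"
    and base: "P A"
    and right: "\<And>t. A \<le> t \<Longrightarrow> t < B \<Longrightarrow> P t \<Longrightarrow> \<forall>\<^sub>F s in at_right t. P s"
    and left: "\<And>t. A < t \<Longrightarrow> t \<le> B \<Longrightarrow> (\<And>s. A \<le> s \<Longrightarrow> s < t \<Longrightarrow> P s) \<Longrightarrow> P t"
  shows "P B"
proof (rule ccontr)
  assume "\<not> P B"
  define N where "N = {t \<in> {A..B}. \<not> P t}"
  define c where "c = Inf N"
  have "B \<in> N" using \<open>\<not> P B\<close> \<open>A \<le> B\<close> by (simp add: N_def)
  have bdd: "bdd_below N" by (rule bdd_belowI[of _ A]) (simp add: N_def)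
  have "c \<le> B" unfolding c_def by (rule cInf_lower[OF \<open>B \<in> N\<close> bdd])
  have "A \<le> c" unfolding c_def
    by (rule cInf_greatest) (use \<open>B \<in> N\<close> in \<open>auto simp: N_def\<close>)
  have below: "P s" if "A \<le> s" "s < c" for s
    using cInf_lower[OF _ bdd, of s] that \<open>c \<le> B\<close> by (auto simp: N_def c_def)
  have "P c"
    using base left[of c] below \<open>A \<le> c\<close> \<open>c \<le> B\<close> by (cases "c = A") auto
  hence "c < B" using \<open>\<not> P B\<close> \<open>c \<le> B\<close> by (cases "c = B") auto
  obtain e where e: "e > c" "\<And>s. c < s \<Longrightarrow> s < e \<Longrightarrow> P s"
    using right[OF \<open>A \<le> c\<close> \<open>c < B\<close> \<open>P c\<close>] unfolding eventually_at_right_field by blast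
  have "e \<le> c" unfolding c_def
  proof (rule cInf_greatest)
    fix t assume "t \<in> N"
    hence "c \<le> t" "\<not> P t" using cInf_lower[OF _ bdd] by (auto simp: c_def N_def)
    thus "e \<le> t" using e(2)[of t] \<open>P c\<close> by (cases "c = t") force+
  qed (use \<open>B \<in> N\<close> in auto)
  thus False using e(1) by simp
qed

section \<open>Counting impulses\<close>

lemma locally_finite_isolated:
  fixes T :: "real set"
  assumes "\<And>t. finite (T \<inter> {..t})"
  obtains e where "e > 0" "\<And>s. s \<in> T \<Longrightarrow> \<bar>s - t\<bar> < e \<Longrightarrow> s = t"
proof -
  obtain e where e: "e > 0" "\<forall>x\<in>T \<inter> {..t + 1}. x \<noteq> t \<longrightarrow> e \<le> dist t x"
    using finite_set_avoid[OF assms[of "t + 1"], of t] by blast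
  show thesis
  proof (rule that[of "min e 1"])
    fix s assume "s \<in> T" "\<bar>s - t\<bar> < min e 1"
    moreover from this have "s \<le> t + 1" by linarith
    ultimately show "s = t" using e(2)[rule_format, of s]
      by (cases "s = t") (auto simp: dist_real_def abs_minus_commute)
  qed (use e in simp)
qed

text \<open>
  The interval is open at \<open>A\<close> and closed at \<open>t\<close> because the functions considered here are
  right-continuous: the value at \<open>A\<close> already includes a jump at \<open>A\<close>, and the value at \<open>t\<close>
  includes a jump at \<open>t\<close>.
\<close>

definition impulses :: "real set \<Rightarrow> real \<Rightarrow> real \<Rightarrow> nat" where
  "impulses T A t = card (T \<inter> {A<..t})"

lemma impulses_eventually_right:
  assumes "\<And>t. finite (T \<inter> {..t})" "A \<le> t"
  shows "\<forall>\<^sub>F s in at_right t. impulses T A s = impulses T A t"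
proof -
  obtain e where e: "e > 0" "\<And>s. s \<in> T \<Longrightarrow> \<bar>s - t\<bar> < e \<Longrightarrow> s = t"
    using locally_finite_isolated assms(1) by metis
  have "impulses T A s = impulses T A t" if "t < s" "s < t + e" for s
  proof -
    have "T \<inter> {A<..s} = T \<inter> {A<..t}"
    proof (intro equalityI subsetI)
      fix x assume x: "x \<in> T \<inter> {A<..s}"
      show "x \<in> T \<inter> {A<..t}"
        using e(2)[of x] x that by (cases "x \<le> t") auto
    qed (use that in auto)
    thus ?thesis by (simp add: impulses_def)
  qed
  thus ?thesis unfolding eventually_at_right_field using e(1)
    by (intro exI[of _ "t + e"]) auto
qed

lemma impulses_eventually_left:
  assumes fin: "\<And>t. finite (T \<inter> {..t})" and "A < t"
  shows "\<forall>\<^sub>F s in at_left t. impulses T A t = (if t \<in> T then Suc (impulses T A s) else impulses T A s)"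
proof -
  obtain e where e: "e > 0" "\<And>s. s \<in> T \<Longrightarrow> \<bar>s - t\<bar> < e \<Longrightarrow> s = t"
    using locally_finite_isolated assms(1) by metis
  have "impulses T A t = (if t \<in> T then Suc (impulses T A s) else impulses T A s)"
    if "t - e < s" "s < t" "A < s" for s
  proof -
    have *: "x \<le> s" if x: "x \<in> T" "x \<le> t" "x \<noteq> t" for x
      using e(2)[of x] x \<open>t - e < s\<close> by force
    have "T \<inter> {A<..t} = (if t \<in> T then insert t (T \<inter> {A<..s}) else T \<inter> {A<..s})"
      using that assms(2) * by (auto; force)
    moreover have "finite (T \<inter> {A<..s})" by (rule finite_subset[OF _ fin[of s]]) auto
    ultimately show ?thesis using that by (simp add: impulses_def)
  qed
  thus ?thesis unfolding eventually_at_left_field using e(1) assms(2)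
    by (intro exI[of _ "max A (t - e)"]) auto
qed

section \<open>A Gronwall inequality with jumps\<close>

text \<open>
  The right-hand side, with \<open>B\<close> replaced by \<open>t\<close>, is a supersolution: it solves the linear
  equation up to a surplus in the term \<open>\<rho>\<close>, and its jumps are at least those allowed for \<open>w\<close>.
  Raising \<open>\<rho>\<close> to \<open>\<rho> + e\<close> makes it strict, so that \<open>w\<close> cannot cross it, and then \<open>e\<close> tends
  to 0.

  The surplus is nonnegative because \<open>m ^ n * exp (\<kappa> * (t - A)) \<ge> 1\<close>, which needs \<open>\<kappa> \<ge> 0\<close>,
  unless \<open>\<rho>\<close> and \<open>\<sigma>\<close> vanish; hence the two alternatives for the sign. A negative \<open>\<kappa>\<close>
  describes damping between the impulses.
\<close>

lemma impulsive_gronwall: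
  fixes w :: "real \<Rightarrow> real"
  assumes "A \<le> B"
    and fin: "\<And>t. finite (T \<inter> {..t})"
    and rate: "\<And>t e. A \<le> t \<Longrightarrow> t < B \<Longrightarrow> e > 0 \<Longrightarrow>
      \<forall>\<^sub>F s in at_right t. w s \<le> w t + (s - t) * (\<kappa> * w t + \<rho> + e)"
    and cont: "\<And>t. A < t \<Longrightarrow> t \<le> B \<Longrightarrow> t \<notin> T \<Longrightarrow> (w \<longlongrightarrow> w t) (at_left t)"
    and jump: "\<And>t. A < t \<Longrightarrow> t \<le> B \<Longrightarrow> t \<in> T \<Longrightarrow>
      \<exists>L. (w \<longlongrightarrow> L) (at_left t) \<and> w t \<le> m * L + \<sigma>"
    and "m \<ge> 1" "w A \<ge> 0" "\<rho> \<ge> 0" "\<sigma> \<ge> 0"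
    and sign: "\<kappa> \<ge> 0 \<or> \<rho> = 0 \<and> \<sigma> = 0"
  shows "w B \<le> m ^ impulses T A B * exp (\<kappa> * (B - A))
           * (w A + \<rho> * (B - A) + \<sigma> * impulses T A B)"
proof -
  define W where "W = (\<lambda>e n t. m ^ n * exp (\<kappa> * (t - A)) * (w A + (\<rho> + e) * (t - A) + \<sigma> * real n))"
  have W_nonneg: "W e n t \<ge> 0" if "e \<ge> 0" "A \<le> t" for e n t
    using that assms by (auto simp: W_def intro!: mult_nonneg_nonneg add_nonneg_nonneg)
  have strict: "w B \<le> W e (impulses T A B) B" if "e > 0" for e
    using \<open>A \<le> B\<close>
  proof (induction rule: real_interval_induct)
    case base
    show ?case by (simp add: W_def impulses_def)
  next
    case (right t)
    define n where "n = impulses T A t"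
    define K where "K = m ^ n * exp (\<kappa> * (t - A))"
    have "K > 0" using \<open>m \<ge> 1\<close> by (simp add: K_def)
    have Q: "K * (\<rho> + e) > \<rho>"
    proof (cases "\<rho> = 0")
      case True
      thus ?thesis using \<open>K > 0\<close> \<open>e > 0\<close> by simp
    next
      case False
      hence "\<kappa> * (t - A) \<ge> 0" using sign right by auto
      hence "K \<ge> 1" unfolding K_def using \<open>m \<ge> 1\<close>
        by (metis mult_ge1_I one_le_exp_iff one_le_power)
      hence "1 * (\<rho> + e) \<le> K * (\<rho> + e)" using \<open>\<rho> \<ge> 0\<close> \<open>e > 0\<close> by (intro mult_right_mono) auto
      thus ?thesis using \<open>e > 0\<close> by simp
    qed
    \<comment> \<open>The surplus \<open>K * (\<rho> + e) - \<rho>\<close> of the supersolution is positive; half of it pays for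
      the loss in the growth rate of \<open>w\<close>, the rest for replacing \<open>exp\<close> by its tangent below.\<close>
    define e' where "e' = (K * (\<rho> + e) - \<rho>) / 2"
    have "e' > 0" using Q by (simp add: e'_def)
    have small: "\<forall>\<^sub>F s in at_right t. 0 < 1 + \<kappa> * (s - t) \<and> \<rho> + e' < (1 + \<kappa> * (s - t)) * (K * (\<rho> + e))"
    proof -
      have l1: "((\<lambda>s. 1 + \<kappa> * (s - t)) \<longlongrightarrow> 1 + \<kappa> * (t - t)) (at_right t)"
        by (intro tendsto_intros)
      hence "((\<lambda>s. (1 + \<kappa> * (s - t)) * (K * (\<rho> + e))) \<longlongrightarrow> (1 + \<kappa> * (t - t)) * (K * (\<rho> + e))) (at_right t)"
        by (intro tendsto_intros)
      moreover have "\<rho> + e' < (1 + \<kappa> * (t - t)) * (K * (\<rho> + e))"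
        using Q by (simp add: e'_def field_simps)
      ultimately show ?thesis using order_tendstoD(1)[OF l1, of 0]
        by (auto intro: eventually_conj dest: order_tendstoD(1))
    qed
    have "\<forall>\<^sub>F s in at_right t. t < s" by (simp add: eventually_at_right_less)
    with small rate[OF \<open>A \<le> t\<close> \<open>t < B\<close> \<open>e' > 0\<close>] impulses_eventually_right[OF fin \<open>A \<le> t\<close>]
    show ?case
    proof eventually_elim
      case (elim s)
      define x where "x = 1 + \<kappa> * (s - t)"
      have x: "0 < x" "\<rho> + e' \<le> x * (K * (\<rho> + e))" "x \<le> exp (\<kappa> * (s - t))" "s - t > 0"
        using elim exp_ge_add_one_self[of "\<kappa> * (s - t)"] by (auto simp: x_def)
      have "w s \<le> x * w t + (s - t) * (\<rho> + e')"
        using elim by (simp add: x_def algebra_simps)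
      also have "\<dots> \<le> x * W e n t + (s - t) * (x * (K * (\<rho> + e)))"
        using right(3) x by (intro add_mono mult_left_mono) (auto simp: n_def)
      also have "\<dots> = x * (W e n t + K * (\<rho> + e) * (s - t))" by (simp add: algebra_simps)
      also have "\<dots> \<le> exp (\<kappa> * (s - t)) * (W e n t + K * (\<rho> + e) * (s - t))"
        using x W_nonneg[of e t n] right \<open>e > 0\<close> \<open>K > 0\<close> \<open>\<rho> \<ge> 0\<close>
        by (intro mult_right_mono add_nonneg_nonneg mult_nonneg_nonneg) auto
      also have "W e n t + K * (\<rho> + e) * (s - t) = K * (w A + (\<rho> + e) * (s - A) + \<sigma> * real n)"
        by (simp add: W_def K_def algebra_simps)
      also have "exp (\<kappa> * (s - t)) * (K * (w A + (\<rho> + e) * (s - A) + \<sigma> * real n)) = W e n s"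
      proof -
        have "exp (\<kappa> * (s - A)) = exp (\<kappa> * (s - t)) * exp (\<kappa> * (t - A))"
          by (simp add: exp_add[symmetric] algebra_simps)
        thus ?thesis by (simp add: W_def K_def)
      qed
      finally show ?case using elim by (simp add: n_def)
    qed
  next
    case (left t)
    \<comment> \<open>the number of impulses just before \<open>t\<close>\<close>
    define n where "n = (if t \<in> T then impulses T A t - 1 else impulses T A t)"
    obtain L where L: "(w \<longlongrightarrow> L) (at_left t)" "w t \<le> (if t \<in> T then m * L + \<sigma> else L)"
      using cont[OF left(1,2)] jump[OF left(1,2)] by (cases "t \<in> T") auto
    have "\<forall>\<^sub>F s in at_left t. A < s"
      using eventually_at_left_field left(1) by blast
    moreover have "\<forall>\<^sub>F s in at_left t. s < t" by (simp add: eventually_at_filter)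
    ultimately have near: "\<forall>\<^sub>F s in at_left t. w s \<le> W e n s \<and>
        impulses T A t = (if t \<in> T then Suc n else n)"
      using impulses_eventually_left[OF fin left(1)]
    proof eventually_elim
      case (elim s)
      hence "impulses T A s = n" by (auto simp: n_def split: if_splits)
      thus ?case using left(3)[of s] elim by auto
    qed
    have nt: "impulses T A t = (if t \<in> T then Suc n else n)"
      using eventually_happens'[OF _ near] by auto
    have "((\<lambda>s. W e n s) \<longlongrightarrow> W e n t) (at_left t)"
      unfolding W_def by (intro tendsto_intros)
    hence "L \<le> W e n t"
      by (rule tendsto_le[OF _ _ L(1), rotated]) (use near in \<open>auto elim: eventually_mono\<close>)
    show ?case
    proof (cases "t \<in> T")
      case False
      thus ?thesis using L \<open>L \<le> W e n t\<close> nt by simp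
    next
      case True
      have "w t \<le> m * W e n t + \<sigma>"
        using L(2) True \<open>L \<le> W e n t\<close> \<open>m \<ge> 1\<close> by (smt (verit) mult_left_mono)
      also have "\<dots> \<le> m * W e n t + m ^ Suc n * exp (\<kappa> * (t - A)) * \<sigma>"
      proof (cases "\<sigma> = 0")
        case False
        hence "\<kappa> * (t - A) \<ge> 0" using sign left by auto
        hence "m ^ Suc n * exp (\<kappa> * (t - A)) \<ge> 1" using \<open>m \<ge> 1\<close>
          by (metis mult_ge1_I one_le_exp_iff one_le_power)
        hence "1 * \<sigma> \<le> m ^ Suc n * exp (\<kappa> * (t - A)) * \<sigma>" using \<open>\<sigma> \<ge> 0\<close>
          by (intro mult_right_mono) auto
        thus ?thesis by simp
      qed simp
      also have "\<dots> = W e (Suc n) t" by (simp add: W_def algebra_simps)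
      finally show ?thesis using True nt by simp
    qed
  qed
  have "((\<lambda>e. W e (impulses T A B) B) \<longlongrightarrow> W 0 (impulses T A B) B) (at_right 0)"
    unfolding W_def by (intro tendsto_intros)
  hence "w B \<le> W 0 (impulses T A B) B"
    by (rule tendsto_lowerbound) (use strict in \<open>auto simp: eventually_at_filter\<close>)
  thus ?thesis by (simp add: W_def)
qed

section \<open>One-sided growth of the 1-norm\<close>

lemma norm1_nonneg: "0 \<le> norm1 u"
  by (simp add: norm1_def sum_nonneg)

lemma norm1_zero [simp]: "norm1 0 = 0"
  by (simp add: norm1_def)

lemma norm1_triangle: "norm1 (u + v) \<le> norm1 u + norm1 v"
  unfolding norm1_def sum.distrib[symmetric] by (intro sum_mono) (simp add: abs_triangle_ineq)

lemma norm1_scaleR: "norm1 (r *\<^sub>R u) = \<bar>r\<bar> * norm1 u"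
  by (simp add: norm1_def abs_mult sum_distrib_left)

lemma tendsto_norm1 [tendsto_intros]: "(x \<longlongrightarrow> l) F \<Longrightarrow> ((\<lambda>t. norm1 (x t)) \<longlongrightarrow> norm1 l) F"
  unfolding norm1_def by (intro tendsto_intros)

text \<open>
  The 1-norm has no derivative in general, so growth is measured by its increment along the
  tangent, with a loss \<open>e\<close> that absorbs the error of the linear approximation.
\<close>

lemma norm1_right_growth:
  assumes x: "(x has_vector_derivative D) (at_right t)"
    and dir: "\<forall>\<^sub>F h in at_right 0. norm1 (x t + h *\<^sub>R D) \<le> norm1 (x t) + h * r"
    and "e > 0"
  shows "\<forall>\<^sub>F s in at_right t. norm1 (x s) \<le> norm1 (x t) + (s - t) * (r + e)"
proof -
  define E where "E = (\<lambda>s. x s - x t - (s - t) *\<^sub>R D)"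
  have comp: "((\<lambda>s. \<bar>E s $ i / (s - t)\<bar>) \<longlongrightarrow> 0) (at_right t)" for i
  proof -
    have "((\<lambda>s. x s $ i) has_vector_derivative D $ i) (at_right t)"
      by (rule bounded_linear.has_vector_derivative[OF bounded_linear_vec_nth x])
    hence "((\<lambda>s. (x s $ i - x t $ i) / (s - t)) \<longlongrightarrow> D $ i) (at_right t)"
      by (simp add: has_real_derivative_iff_has_vector_derivative[symmetric] has_field_derivative_iff)
    hence "((\<lambda>s. (x s $ i - x t $ i) / (s - t) - D $ i) \<longlongrightarrow> 0) (at_right t)"
      by (simp add: LIM_zero_iff)
    hence "((\<lambda>s. \<bar>(x s $ i - x t $ i) / (s - t) - D $ i\<bar>) \<longlongrightarrow> 0) (at_right t)"
      by (rule tendsto_rabs_zero)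
    thus ?thesis
      by (rule Lim_transform_eventually)
        (auto simp: eventually_at_filter E_def field_simps)
  qed
  have "((\<lambda>s. \<Sum>i\<in>UNIV. \<bar>E s $ i / (s - t)\<bar>) \<longlongrightarrow> (\<Sum>i::'a\<in>UNIV. 0)) (at_right t)"
    by (intro tendsto_sum comp)
  hence "\<forall>\<^sub>F s in at_right t. (\<Sum>i\<in>UNIV. \<bar>E s $ i / (s - t)\<bar>) < e"
    using order_tendstoD(2) \<open>e > 0\<close> by fastforce
  moreover have "\<forall>\<^sub>F s in at_right t. t < s" by (simp add: eventually_at_right_less)
  moreover have "\<forall>\<^sub>F s in at_right t. norm1 (x t + (s - t) *\<^sub>R D) \<le> norm1 (x t) + (s - t) * r"
    using dir by (subst at_right_to_0) (simp add: eventually_filtermap)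
  ultimately show ?thesis
  proof eventually_elim
    case (elim s)
    have "norm1 (E s) \<le> (s - t) * e"
      using elim by (simp add: norm1_def sum_divide_distrib[symmetric] field_simps)
    moreover have "norm1 (x s) = norm1 ((x t + (s - t) *\<^sub>R D) + E s)" by (simp add: E_def)
    ultimately have "norm1 (x s) \<le> norm1 (x t) + (s - t) * r + (s - t) * e"
      using norm1_triangle[of "x t + (s - t) *\<^sub>R D" "E s"] elim(3) by linarith
    thus ?case by (simp add: algebra_simps)
  qed
qed

lemma norm1_right_growth_derivative:
  assumes "(x has_vector_derivative D) (at_right t)" "norm1 D \<le> r" "e > 0"
  shows "\<forall>\<^sub>F s in at_right t. norm1 (x s) \<le> norm1 (x t) + (s - t) * (r + e)"
proof (rule norm1_right_growth[OF assms(1) _ assms(3)])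
  have "norm1 (x t + h *\<^sub>R D) \<le> norm1 (x t) + h * r" if "h > 0" for h
  proof -
    have "norm1 (h *\<^sub>R D) \<le> h * r"
      using mult_left_mono[OF assms(2), of h] that by (simp add: norm1_scaleR)
    thus ?thesis using norm1_triangle[of "x t" "h *\<^sub>R D"] by linarith
  qed
  thus "\<forall>\<^sub>F h in at_right 0. norm1 (x t + h *\<^sub>R D) \<le> norm1 (x t) + h * r"
    by (simp add: eventually_at_filter)
qed

text \<open>
  The triangle inequality for \<open>D\<close> would count the damping term with the wrong sign. For
  small \<open>h\<close> the factors \<open>1 - h * a i\<close> are positive, so the damping contracts each component and
  contributes the negative rate \<open>- \<gamma>\<close>.
\<close>

lemma norm1_right_growth_damped:
  fixes x :: "real \<Rightarrow> real ^ 'm::finite"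
  assumes x: "(x has_vector_derivative D) (at_right t)"
    and D: "\<And>i. D $ i = - a i * x t $ i + v $ i"
    and a: "\<And>i. \<gamma> \<le> a i"
    and "e > 0"
  shows "\<forall>\<^sub>F s in at_right t. norm1 (x s) \<le> norm1 (x t) + (s - t) * (- \<gamma> * norm1 (x t) + norm1 v + e)"
proof (rule norm1_right_growth[OF x _ \<open>e > 0\<close>])
  have "\<forall>\<^sub>F h in at_right 0. h * a i < 1" for i
  proof -
    have "((\<lambda>h. h * a i) \<longlongrightarrow> 0 * a i) (at_right 0)" by (intro tendsto_intros)
    thus ?thesis by (rule order_tendstoD) simp
  qed
  hence "\<forall>\<^sub>F h in at_right 0. \<forall>i. h * a i < 1"
    by (rule eventually_all_finite)
  moreover have "\<forall>\<^sub>F h :: real in at_right 0. 0 < h" by (simp add: eventually_at_right_less)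
  ultimately show "\<forall>\<^sub>F h in at_right 0. norm1 (x t + h *\<^sub>R D)
      \<le> norm1 (x t) + h * (- \<gamma> * norm1 (x t) + norm1 v)"
  proof eventually_elim
    case (elim h)
    have "\<bar>(x t + h *\<^sub>R D) $ i\<bar> \<le> (1 - h * \<gamma>) * \<bar>x t $ i\<bar> + h * \<bar>v $ i\<bar>" for i
    proof -
      have "(x t + h *\<^sub>R D) $ i = (1 - h * a i) * x t $ i + h * v $ i"
        by (simp add: D algebra_simps)
      also have "\<bar>\<dots>\<bar> \<le> (1 - h * a i) * \<bar>x t $ i\<bar> + h * \<bar>v $ i\<bar>"
        using elim abs_triangle_ineq[of "(1 - h * a i) * x t $ i" "h * v $ i"]
        by (simp add: abs_mult less_imp_le)
      also have "\<dots> \<le> (1 - h * \<gamma>) * \<bar>x t $ i\<bar> + h * \<bar>v $ i\<bar>"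
        using elim a[of i] by (intro add_mono mult_right_mono) auto
      finally show ?thesis .
    qed
    hence "norm1 (x t + h *\<^sub>R D) \<le> (\<Sum>i\<in>UNIV. (1 - h * \<gamma>) * \<bar>x t $ i\<bar> + h * \<bar>v $ i\<bar>)"
      unfolding norm1_def by (intro sum_mono)
    also have "\<dots> = (1 - h * \<gamma>) * norm1 (x t) + h * norm1 v"
      by (simp add: norm1_def sum.distrib sum_distrib_left)
    finally show ?case by (simp add: algebra_simps)
  qed
qed

section \<open>Estimates for an impulsive equation with delayed argument\<close>

text \<open>
  Two applications of Gronwall's inequality. The first bounds \<open>y\<close> on \<open>[A, t]\<close> by
  \<open>M\<close>, a multiple of \<open>norm1 (y A)\<close>. Inserting this into the rates and jumps, the second bounds
  the distance of \<open>y t\<close> from \<open>y A\<close>, and the claim is the triangle inequality for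
  \<open>y A = y t - (y t - y A)\<close>.
\<close>

lemma norm1_at_delayed_argument_le:
  fixes y :: "real \<Rightarrow> real ^ 'm::finite"
  assumes "A \<le> t" "t - A \<le> h"
    and fin: "\<And>t. finite (T \<inter> {..t})"
    and deriv: "\<And>s. A \<le> s \<Longrightarrow> s < t \<Longrightarrow> \<exists>D. (y has_vector_derivative D) (at_right s) \<and>
      norm1 D \<le> k1 * norm1 (y s) + k2 * norm1 (y A)"
    and cont: "\<And>s. A < s \<Longrightarrow> s \<le> t \<Longrightarrow> s \<notin> T \<Longrightarrow> (y \<longlongrightarrow> y s) (at_left s)"
    and jump: "\<And>s. A < s \<Longrightarrow> s \<le> t \<Longrightarrow> s \<in> T \<Longrightarrow>
      \<exists>L. (y \<longlongrightarrow> L) (at_left s) \<and> norm1 (y s - L) \<le> l * norm1 L"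
    and count: "impulses T A t \<le> p"
    and "k1 \<ge> 0" "k2 \<ge> 0" "l \<ge> 0"
  shows "(1 - (k2 * h + (k1 * h + l * real p) * (1 + k2 * h) * (1 + l) ^ p * exp (k1 * h)))
     * norm1 (y A) \<le> norm1 (y t)"
proof -
  define v where "v = norm1 (y A)"
  have "v \<ge> 0" "h \<ge> 0" using assms by (simp_all add: v_def norm1_nonneg)
  define M where "M = (1 + k2 * h) * (1 + l) ^ p * exp (k1 * h) * v"
  have "M \<ge> 0" using \<open>v \<ge> 0\<close> \<open>h \<ge> 0\<close> \<open>k2 \<ge> 0\<close> \<open>l \<ge> 0\<close> by (simp add: M_def)
  have impulses_le: "impulses T A s \<le> p" if "s \<le> t" for s
  proof -
    have "impulses T A s \<le> impulses T A t" unfolding impulses_def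
      by (rule card_mono) (use that in \<open>auto intro: finite_subset[OF _ fin[of t]]\<close>)
    thus ?thesis using count by simp
  qed
  have bound: "norm1 (y s) \<le> M" if s: "A \<le> s" "s \<le> t" for s
  proof -
    have "norm1 (y s) \<le> (1 + l) ^ impulses T A s * exp (k1 * (s - A))
        * (norm1 (y A) + k2 * v * (s - A) + 0 * real (impulses T A s))"
    proof (rule impulsive_gronwall[OF \<open>A \<le> s\<close> fin])
      fix u and e :: real assume u: "A \<le> u" "u < s" "e > 0"
      then obtain D where D: "(y has_vector_derivative D) (at_right u)"
          "norm1 D \<le> k1 * norm1 (y u) + k2 * v"
        using deriv[of u] s by (auto simp: v_def)
      show "\<forall>\<^sub>F x in at_right u. norm1 (y x) \<le> norm1 (y u) + (x - u) * (k1 * norm1 (y u) + k2 * v + e)"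
        by (rule norm1_right_growth_derivative[OF D \<open>e > 0\<close>])
    next
      fix u assume u: "A < u" "u \<le> s" "u \<notin> T"
      show "((\<lambda>x. norm1 (y x)) \<longlongrightarrow> norm1 (y u)) (at_left u)"
        using u s by (intro tendsto_norm1 cont) auto
    next
      fix u assume u: "A < u" "u \<le> s" "u \<in> T"
      then obtain L where L: "(y \<longlongrightarrow> L) (at_left u)" "norm1 (y u - L) \<le> l * norm1 L"
        using jump[of u] s by auto
      have "norm1 (y u) \<le> (1 + l) * norm1 L + 0"
        using norm1_triangle[of "y u - L" L] L(2) by (simp add: algebra_simps)
      thus "\<exists>L. ((\<lambda>x. norm1 (y x)) \<longlongrightarrow> L) (at_left u) \<and> norm1 (y u) \<le> (1 + l) * L + 0"
        using tendsto_norm1[OF L(1)] by blast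
    qed (use \<open>v \<ge> 0\<close> assms in \<open>auto simp: norm1_nonneg\<close>)
    also have "\<dots> \<le> (1 + l) ^ p * exp (k1 * h) * (v + k2 * v * h)"
    proof (intro mult_mono)
      show "norm1 (y A) + k2 * v * (s - A) + 0 * real (impulses T A s) \<le> v + k2 * v * h"
        using s assms \<open>v \<ge> 0\<close> by (auto simp: v_def intro!: mult_left_mono)
      show "(1 + l) ^ impulses T A s \<le> (1 + l) ^ p"
        using impulses_le[OF s(2)] \<open>l \<ge> 0\<close> by (intro power_increasing) auto
      show "exp (k1 * (s - A)) \<le> exp (k1 * h)"
        using s assms by (auto intro!: mult_left_mono)
    qed (use s assms \<open>v \<ge> 0\<close> in \<open>auto simp: norm1_nonneg\<close>)
    also have "\<dots> = M" by (simp add: M_def algebra_simps)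
    finally show ?thesis .
  qed
  have "norm1 (y t - y A) \<le> 1 ^ impulses T A t * exp (0 * (t - A))
      * (norm1 (y A - y A) + (k1 * M + k2 * v) * (t - A) + l * M * impulses T A t)"
  proof (rule impulsive_gronwall[OF \<open>A \<le> t\<close> fin])
    fix u and e :: real assume u: "A \<le> u" "u < t" "e > 0"
    then obtain D where D: "(y has_vector_derivative D) (at_right u)"
        "norm1 D \<le> k1 * norm1 (y u) + k2 * v"
      using deriv[of u] by (auto simp: v_def)
    have "norm1 D \<le> k1 * M + k2 * v"
      using D(2) mult_left_mono[OF bound[of u] \<open>k1 \<ge> 0\<close>] u by linarith
    hence "norm1 D \<le> 0 * norm1 (y u - y A) + (k1 * M + k2 * v)" by simp
    moreover have "((\<lambda>x. y x - y A) has_vector_derivative D) (at_right u)"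
      using D(1) by (simp add: has_vector_derivative_diff_const)
    ultimately show "\<forall>\<^sub>F x in at_right u. norm1 (y x - y A)
        \<le> norm1 (y u - y A) + (x - u) * (0 * norm1 (y u - y A) + (k1 * M + k2 * v) + e)"
      using norm1_right_growth_derivative[of "\<lambda>x. y x - y A"] \<open>e > 0\<close> by blast
  next
    fix u assume u: "A < u" "u \<le> t" "u \<notin> T"
    show "((\<lambda>x. norm1 (y x - y A)) \<longlongrightarrow> norm1 (y u - y A)) (at_left u)"
      using u by (intro tendsto_intros cont)
  next
    fix u assume u: "A < u" "u \<le> t" "u \<in> T"
    then obtain L where L: "(y \<longlongrightarrow> L) (at_left u)" "norm1 (y u - L) \<le> l * norm1 L"
      using jump[of u] by auto
    have "\<forall>\<^sub>F s in at_left u. norm1 (y s) \<le> M"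
      unfolding eventually_at_left_field using u bound by (intro exI[of _ A]) auto
    hence "norm1 L \<le> M"
      by (intro tendsto_upperbound[OF tendsto_norm1[OF L(1)]]) auto
    hence "l * norm1 L \<le> l * M" using \<open>l \<ge> 0\<close> by (intro mult_left_mono)
    hence "norm1 (y u - y A) \<le> 1 * norm1 (L - y A) + l * M"
      using norm1_triangle[of "y u - L" "L - y A"] L(2) by simp
    moreover have "((\<lambda>x. norm1 (y x - y A)) \<longlongrightarrow> norm1 (L - y A)) (at_left u)"
      by (intro tendsto_intros L)
    ultimately show "\<exists>N. ((\<lambda>x. norm1 (y x - y A)) \<longlongrightarrow> N) (at_left u) \<and>
        norm1 (y u - y A) \<le> 1 * N + l * M"
      by blast
  qed (use \<open>v \<ge> 0\<close> \<open>M \<ge> 0\<close> assms in \<open>auto simp: norm1_nonneg\<close>)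
  also have "\<dots> = (k1 * M + k2 * v) * (t - A) + l * M * impulses T A t" by simp
  also have "\<dots> \<le> (k1 * M + k2 * v) * h + l * M * p"
    using assms \<open>v \<ge> 0\<close> \<open>M \<ge> 0\<close> by (intro add_mono mult_left_mono) auto
  finally have "norm1 (y t - y A) \<le> (k1 * M + k2 * v) * h + l * M * p" .
  moreover have "v \<le> norm1 (y t) + norm1 (y t - y A)"
    using norm1_triangle[of "y t" "- (y t - y A)"] norm1_scaleR[of "-1" "y t - y A"]
    by (simp add: v_def)
  ultimately show ?thesis
    by (simp add: v_def[symmetric] M_def algebra_simps)
qed

lemma finite_range_atMost:
  fixes \<tau> :: "nat \<Rightarrow> real"
  assumes "filterlim \<tau> at_top sequentially"
  shows "finite (range \<tau> \<inter> {..t})"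
proof -
  obtain N where "\<And>n. n \<ge> N \<Longrightarrow> t < \<tau> n"
    using assms by (auto simp: filterlim_at_top_dense eventually_sequentially)
  hence "range \<tau> \<inter> {..t} \<subseteq> \<tau> ` {..<N}"
    by (force simp: not_le)
  thus ?thesis by (rule finite_subset) simp
qed

text \<open>
  If the first and the last impulse in \<open>(A, t]\<close> are the \<open>i\<close>-th and the \<open>j\<close>-th, then
  \<open>(j - i) * \<delta> \<le> t - A\<close>, and there are at most \<open>j - i + 1\<close> of them.
\<close>

lemma impulses_le_separated:
  fixes \<tau> :: "nat \<Rightarrow> real"
  assumes lim: "filterlim \<tau> at_top sequentially" and gap: "\<And>k. \<delta> \<le> \<tau> (Suc k) - \<tau> k"
    and "\<delta> > 0" "A \<le> t"
  shows "real (impulses (range \<tau>) A t) \<le> 1 + (t - A) / \<delta>"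
proof (cases "range \<tau> \<inter> {A<..t} = {}")
  case True
  thus ?thesis using assms by (simp add: impulses_def)
next
  case False
  have sep: "\<tau> i + real n * \<delta> \<le> \<tau> (i + n)" for i n
  proof (induction n)
    case (Suc n)
    thus ?case using gap[of "i + n"] by (simp add: algebra_simps)
  qed simp
  define S where "S = {k. A < \<tau> k \<and> \<tau> k \<le> t}"
  have "inj \<tau>"
  proof (rule linorder_injI)
    fix i j :: nat assume "i < j"
    thus "\<tau> i \<noteq> \<tau> j"
      using sep[of i "j - i"] \<open>\<delta> > 0\<close> by (smt (verit) le_add_diff_inverse less_imp_le_nat mult_pos_pos of_nat_0_less_iff zero_less_diff)
  qed
  have img: "range \<tau> \<inter> {A<..t} = \<tau> ` S" by (auto simp: S_def)
  have "finite (\<tau> ` S)" unfolding img[symmetric]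
    by (rule finite_subset[OF _ finite_range_atMost[OF lim, of t]]) auto
  hence "finite S" by (rule finite_imageD) (use \<open>inj \<tau>\<close> in \<open>auto simp: inj_on_def\<close>)
  have "S \<noteq> {}" using False img by auto
  define i where "i = Min S"
  define j where "j = Max S"
  have ij: "i \<in> S" "j \<in> S" "i \<le> j" using \<open>finite S\<close> \<open>S \<noteq> {}\<close> by (auto simp: i_def j_def)
  have "impulses (range \<tau>) A t \<le> card S" unfolding impulses_def img by (rule card_image_le) fact
  also have "\<dots> \<le> card {i..j}"
    by (rule card_mono) (use \<open>finite S\<close> in \<open>auto simp: i_def j_def\<close>)
  finally have "real (impulses (range \<tau>) A t) \<le> 1 + real (j - i)" using ij by simp
  moreover have "real (j - i) * \<delta> \<le> t - A"
    using sep[of i "j - i"] ij by (auto simp: S_def)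
  hence "real (j - i) \<le> (t - A) / \<delta>" using \<open>\<delta> > 0\<close> by (simp add: field_simps)
  ultimately show ?thesis by linarith
qed

text \<open>
  The case of \<open>impulsive_gronwall\<close> without sources, where \<open>\<kappa>\<close> may be negative: the
  perturbation \<open>v\<close> takes at most \<open>\<nu>\<close> from the damping rate \<open>\<gamma>\<close>.
\<close>

lemma damped_impulsive_decay:
  fixes y :: "real \<Rightarrow> real ^ 'm::finite"
  assumes "A \<le> t"
    and fin: "\<And>t. finite (T \<inter> {..t})"
    and deriv: "\<And>s. A \<le> s \<Longrightarrow> s < t \<Longrightarrow> \<exists>D v. (y has_vector_derivative D) (at_right s) \<and>
      (\<forall>i. D $ i = - a i * y s $ i + v $ i) \<and> norm1 v \<le> \<nu> * norm1 (y s)"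
    and a: "\<And>i. \<gamma> \<le> a i"
    and cont: "\<And>s. A < s \<Longrightarrow> s \<le> t \<Longrightarrow> s \<notin> T \<Longrightarrow> (y \<longlongrightarrow> y s) (at_left s)"
    and jump: "\<And>s. A < s \<Longrightarrow> s \<le> t \<Longrightarrow> s \<in> T \<Longrightarrow>
      \<exists>L. (y \<longlongrightarrow> L) (at_left s) \<and> norm1 (y s - L) \<le> l * norm1 L"
    and "l \<ge> 0"
  shows "norm1 (y t) \<le> (1 + l) ^ impulses T A t * exp (- (\<gamma> - \<nu>) * (t - A)) * norm1 (y A)"
proof -
  have "norm1 (y t) \<le> (1 + l) ^ impulses T A t * exp (- (\<gamma> - \<nu>) * (t - A))
      * (norm1 (y A) + 0 * (t - A) + 0 * real (impulses T A t))"
  proof (rule impulsive_gronwall[OF \<open>A \<le> t\<close> fin])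
    fix u and e :: real assume u: "A \<le> u" "u < t" "e > 0"
    then obtain D v where D: "(y has_vector_derivative D) (at_right u)"
      "\<And>i. D $ i = - a i * y u $ i + v $ i" and v: "norm1 v \<le> \<nu> * norm1 (y u)"
      using deriv[of u] by auto
    have "\<forall>\<^sub>F x in at_right u. norm1 (y x) \<le> norm1 (y u) + (x - u) * (- \<gamma> * norm1 (y u) + norm1 v + e)"
      by (rule norm1_right_growth_damped[OF D a \<open>e > 0\<close>])
    moreover have "\<forall>\<^sub>F x in at_right u. u < x" by (simp add: eventually_at_right_less)
    ultimately show "\<forall>\<^sub>F x in at_right u. norm1 (y x)
        \<le> norm1 (y u) + (x - u) * (- (\<gamma> - \<nu>) * norm1 (y u) + 0 + e)"
    proof eventually_elim
      case (elim x)
      have "- \<gamma> * norm1 (y u) + norm1 v + e \<le> - (\<gamma> - \<nu>) * norm1 (y u) + 0 + e"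
        using v by (simp add: algebra_simps)
      hence "(x - u) * (- \<gamma> * norm1 (y u) + norm1 v + e)
          \<le> (x - u) * (- (\<gamma> - \<nu>) * norm1 (y u) + 0 + e)"
        using elim(2) by (intro mult_left_mono) auto
      thus ?case using elim(1) by linarith
    qed
  next
    fix u assume u: "A < u" "u \<le> t" "u \<notin> T"
    show "((\<lambda>x. norm1 (y x)) \<longlongrightarrow> norm1 (y u)) (at_left u)"
      using u by (intro tendsto_norm1 cont) auto
  next
    fix u assume u: "A < u" "u \<le> t" "u \<in> T"
    then obtain L where L: "(y \<longlongrightarrow> L) (at_left u)" "norm1 (y u - L) \<le> l * norm1 L"
      using jump[of u] by auto
    have "norm1 (y u) \<le> (1 + l) * norm1 L + 0"
      using norm1_triangle[of "y u - L" L] L(2) by (simp add: algebra_simps)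
    thus "\<exists>L. ((\<lambda>x. norm1 (y x)) \<longlongrightarrow> L) (at_left u) \<and> norm1 (y u) \<le> (1 + l) * L + 0"
      using tendsto_norm1[OF L(1)] by blast
  qed (use \<open>l \<ge> 0\<close> in \<open>auto simp: norm1_nonneg\<close>)
  thus ?thesis by simp
qed

section \<open>Solutions of the network\<close>

lemma piecewise_arg_eq:
  assumes "strict_mono \<theta>" "\<theta> k \<le> t" "t < \<theta> (Suc k)"
  shows "piecewise_arg \<theta> t = \<theta> k"
proof -
  have unique: "j = k" if j: "\<theta> j \<le> t" "t < \<theta> (Suc j)" for j
  proof -
    have "\<theta> j < \<theta> (Suc k)" "\<theta> k < \<theta> (Suc j)" using j assms(2,3) by linarith+
    hence "j < Suc k" "k < Suc j" by (simp_all add: strict_mono_less[OF assms(1)])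
    thus ?thesis by simp
  qed
  have "(THE k. \<theta> k \<le> t \<and> t < \<theta> (Suc k)) = k"
    using assms(2,3) unique by (intro the_equality) blast+
  thus ?thesis by (simp add: piecewise_arg_def)
qed

lemma piecewise_arg_interval:
  assumes "strict_mono \<theta>" "filterlim \<theta> at_top sequentially" "\<theta> 0 \<le> t"
  obtains k where "\<theta> k \<le> t" "t < \<theta> (Suc k)" "piecewise_arg \<theta> t = \<theta> k"
proof -
  obtain n where n: "t < \<theta> n"
    using assms(2) by (auto simp: filterlim_at_top_dense eventually_sequentially)
  define m where "m = (LEAST n. t < \<theta> n)"
  have m: "t < \<theta> m" unfolding m_def by (rule LeastI[of _ n]) (rule n)
  have "m \<noteq> 0" using m assms(3) by (intro notI) simp
  then obtain k where k: "m = Suc k" using not0_implies_Suc by blast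
  have "\<theta> k \<le> t" using not_less_Least[of k "\<lambda>n. t < \<theta> n"] k by (simp add: m_def)
  moreover have "t < \<theta> (Suc k)" using m k by simp
  ultimately show thesis using that piecewise_arg_eq[OF assms(1)] by blast
qed

lemma tendsto_network_rhs:
  assumes "\<And>j v. isCont (f j) v" "(x \<longlongrightarrow> u) F"
  shows "((\<lambda>s. network_rhs a b c d f g (x s) w) \<longlongrightarrow> network_rhs a b c d f g u w) F"
proof -
  have "((\<lambda>s. f j (x s $ j)) \<longlongrightarrow> f j (u $ j)) F" for j
    by (rule isCont_tendsto_compose[OF assms(1) tendsto_vec_nth[OF assms(2)]])
  moreover have "((\<lambda>s. x s $ i) \<longlongrightarrow> u $ i) F" for i
    by (rule tendsto_vec_nth[OF assms(2)])
  ultimately show ?thesis unfolding network_rhs_def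
    by (intro tendsto_vec_lambda tendsto_add tendsto_mult tendsto_sum tendsto_const)
qed

text \<open>
  At an impulse time the differential equation is not imposed. It still holds there for the
  right derivative: this derivative is right-continuous, and just to the right of the impulse it
  is given by the equation, where the delayed argument is constant because impulse times are
  isolated and \<open>\<beta>\<close> is right-continuous.
\<close>

lemma network_solution_right_derivative:
  assumes theta: "strict_mono \<theta>" "filterlim \<theta> at_top sequentially" "\<theta> 0 = 0"
    and tau: "filterlim \<tau> at_top sequentially"
    and f: "\<And>j v. isCont (f j) v"
    and sol: "network_solution a b c d f g I \<tau> \<theta> t0 x"
    and t: "piecewise_arg \<theta> t0 \<le> t" "0 \<le> t"
  shows "(x has_vector_derivative network_rhs a b c d f g (x t) (x (piecewise_arg \<theta> t))) (at_right t)"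
proof -
  define s where "s = piecewise_arg \<theta> t0"
  define r where "r = (\<lambda>t. network_rhs a b c d f g (x t) (x (piecewise_arg \<theta> t)))"
  obtain x' where x': "\<And>t. t \<ge> s \<Longrightarrow> (x has_vector_derivative x' t) (at_right t)"
      "\<And>t. t \<ge> s \<Longrightarrow> continuous (at_right t) x'"
      "\<And>t. t \<ge> s \<Longrightarrow> t \<notin> range \<tau> \<Longrightarrow>
        x' t = network_rhs a b c d f g (x t) (x (piecewise_arg \<theta> t))"
    and x: "\<And>t. t \<ge> s \<Longrightarrow> continuous (at_right t) x"
    using sol unfolding network_solution_def Let_def s_def[symmetric] by blast
  obtain k where k: "\<theta> k \<le> t" "t < \<theta> (Suc k)" "piecewise_arg \<theta> t = \<theta> k"
    using piecewise_arg_interval[OF theta(1,2), of t] theta(3) t by auto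
  obtain e where e: "e > 0" "\<And>u. u \<in> range \<tau> \<Longrightarrow> \<bar>u - t\<bar> < e \<Longrightarrow> u = t"
    using locally_finite_isolated[of "range \<tau>" t] finite_range_atMost[OF tau] by metis
  have near: "network_rhs a b c d f g (x u) (x (\<theta> k)) = x' u"
    if u: "t < u" "u < min (\<theta> (Suc k)) (t + e)" for u
  proof -
    have "u \<notin> range \<tau>" using e(2)[of u] u by auto
    moreover have "piecewise_arg \<theta> u = \<theta> k" using u k by (intro piecewise_arg_eq[OF theta(1)]) auto
    ultimately show ?thesis using x'(3)[of u] u t by (simp add: r_def s_def)
  qed
  have "((\<lambda>u. network_rhs a b c d f g (x u) (x (\<theta> k))) \<longlongrightarrow> r t) (at_right t)"
    unfolding r_def k(3)
    by (intro tendsto_network_rhs f) (use x[of t] t in \<open>simp add: s_def continuous_within\<close>)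
  moreover have "\<forall>\<^sub>F u in at_right t. network_rhs a b c d f g (x u) (x (\<theta> k)) = x' u"
    unfolding eventually_at_right_field
    using k(2) e(1) near by (intro exI[of _ "min (\<theta> (Suc k)) (t + e)"] conjI allI impI) auto
  ultimately have "(x' \<longlongrightarrow> r t) (at_right t)"
    by (rule Lim_transform_eventually)
  moreover have "(x' \<longlongrightarrow> x' t) (at_right t)"
    using x'(2)[of t] t by (simp add: s_def continuous_within)
  ultimately have "x' t = r t" by (intro tendsto_unique[of "at_right t"]) auto
  thus ?thesis using x'(1)[of t] t by (simp add: r_def s_def)
qed

text \<open>
  Exchanging the two sums collects the weights columnwise; this is why the constants of the
  network involve the sums over \<open>j\<close> of \<open>\<bar>b j i\<bar>\<close> and not of \<open>\<bar>b i j\<bar>\<close>.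
\<close>

lemma norm1_lipschitz_coupling:
  fixes u v :: "real ^ 'm::finite"
  assumes "\<And>j r s. \<bar>\<phi> j r - \<phi> j s\<bar> \<le> K j * \<bar>r - s\<bar>"
  shows "norm1 (\<chi> i. \<Sum>j\<in>UNIV. w i j * (\<phi> j (u $ j) - \<phi> j (v $ j)) :: real ^ 'm)
    \<le> (\<Sum>j\<in>UNIV. (K j * (\<Sum>i\<in>UNIV. \<bar>w i j\<bar>)) * \<bar>(u - v) $ j\<bar>)"
proof -
  have "norm1 (\<chi> i. \<Sum>j\<in>UNIV. w i j * (\<phi> j (u $ j) - \<phi> j (v $ j)) :: real ^ 'm)
      \<le> (\<Sum>i\<in>UNIV. \<Sum>j\<in>UNIV. \<bar>w i j\<bar> * (K j * \<bar>(u - v) $ j\<bar>))"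
    unfolding norm1_def
    by (intro sum_mono) (auto simp: abs_mult intro!: order_trans[OF sum_abs] sum_mono mult_left_mono assms)
  also have "\<dots> = (\<Sum>j\<in>UNIV. \<Sum>i\<in>UNIV. \<bar>w i j\<bar> * (K j * \<bar>(u - v) $ j\<bar>))"
    by (rule sum.swap)
  also have "\<dots> = (\<Sum>j\<in>UNIV. (K j * (\<Sum>i\<in>UNIV. \<bar>w i j\<bar>)) * \<bar>(u - v) $ j\<bar>)"
    by (simp add: sum_distrib_left sum_distrib_right algebra_simps)
  finally show ?thesis .
qed

lemma weighted_sum_le_norm1:
  assumes "\<And>j. w j \<le> C"
  shows "(\<Sum>j\<in>UNIV. w j * \<bar>u $ j\<bar>) \<le> C * norm1 u"
  unfolding norm1_def sum_distrib_left using assms by (intro sum_mono mult_right_mono) auto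

text \<open>
  Both solutions are subject to the same impulse functions, so the jump of their difference is a
  difference of two values of \<open>I i k\<close>, taken at the left limits.
\<close>

lemma network_solutions_difference:
  assumes "network_solution a b c d f g I \<tau> \<theta> t0 x" "network_solution a b c d f g I \<tau> \<theta> t1 y"
    and I: "\<And>i k u v. \<bar>I i k u - I i k v\<bar> \<le> l * \<bar>u - v\<bar>"
    and t: "piecewise_arg \<theta> t0 < t" "piecewise_arg \<theta> t1 < t"
  shows "t \<notin> range \<tau> \<Longrightarrow> ((\<lambda>t. x t - y t) \<longlongrightarrow> x t - y t) (at_left t)"
    and "t \<in> range \<tau> \<Longrightarrow> \<exists>L. ((\<lambda>t. x t - y t) \<longlongrightarrow> L) (at_left t) \<and> norm1 (x t - y t - L) \<le> l * norm1 L"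
proof -
  assume "t \<notin> range \<tau>"
  hence "isCont x t" "isCont y t" using assms unfolding network_solution_def Let_def by auto
  thus "((\<lambda>t. x t - y t) \<longlongrightarrow> x t - y t) (at_left t)"
    by (intro tendsto_diff) (auto simp: isCont_def intro: filterlim_at_split[THEN iffD1, THEN conjunct1])
next
  assume "t \<in> range \<tau>"
  then obtain k where k: "t = \<tau> k" by auto
  obtain X where X: "(x \<longlongrightarrow> X) (at_left t)" "\<And>i. x t $ i - X $ i = I i k (X $ i)"
    using assms(1) t(1) unfolding network_solution_def Let_def k by blast
  obtain Y where Y: "(y \<longlongrightarrow> Y) (at_left t)" "\<And>i. y t $ i - Y $ i = I i k (Y $ i)"
    using assms(2) t(2) unfolding network_solution_def Let_def k by blast
  have "(x t - y t - (X - Y)) $ i = I i k (X $ i) - I i k (Y $ i)" for i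
    by (simp add: X(2)[symmetric] Y(2)[symmetric])
  hence "norm1 (x t - y t - (X - Y)) \<le> (\<Sum>i\<in>UNIV. l * \<bar>(X - Y) $ i\<bar>)"
    unfolding norm1_def by (intro sum_mono) (simp add: I)
  also have "\<dots> = l * norm1 (X - Y)" by (simp add: norm1_def sum_distrib_left)
  finally show "\<exists>L. ((\<lambda>t. x t - y t) \<longlongrightarrow> L) (at_left t) \<and> norm1 (x t - y t - L) \<le> l * norm1 L"
    using tendsto_diff[OF X(1) Y(1)] by blast
qed

text \<open>
  The bound with \<open>k1\<close> serves the growth estimate, where the damping counts with its absolute
  value; the splitting into damping and \<open>w\<close> serves the decay estimate, where it counts with its
  sign.
\<close>

lemma network_rhs_difference:
  fixes u v u' v' :: "real ^ 'm::finite" and d :: "'m \<Rightarrow> real"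
  assumes f: "\<And>j r s. \<bar>f j r - f j s\<bar> \<le> Lf j * \<bar>r - s\<bar>"
    and g: "\<And>j r s. \<bar>g j r - g j s\<bar> \<le> Lg j * \<bar>r - s\<bar>"
    and a: "\<And>i. a i \<ge> 0"
    and k1: "\<And>i. a i + Lf i * (\<Sum>j\<in>UNIV. \<bar>b j i\<bar>) \<le> k1"
    and k2: "\<And>i. Lg i * (\<Sum>j\<in>UNIV. \<bar>c j i\<bar>) \<le> k2"
    and mu: "\<And>i. Lf i * (\<Sum>j\<in>UNIV. \<bar>b j i\<bar>) \<le> \<mu>"
  defines "D \<equiv> network_rhs a b c d f g u v - network_rhs a b c d f g u' v'"
  shows "\<exists>w. (\<forall>i. D $ i = - a i * (u - u') $ i + w $ i) \<and>
      norm1 w \<le> \<mu> * norm1 (u - u') + k2 * norm1 (v - v') \<and>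
      norm1 D \<le> k1 * norm1 (u - u') + k2 * norm1 (v - v')"
proof -
  define P :: "real ^ 'm" where "P = (\<chi> i. \<Sum>j\<in>UNIV. b i j * (f j (u $ j) - f j (u' $ j)))"
  define Q :: "real ^ 'm" where "Q = (\<chi> i. \<Sum>j\<in>UNIV. c i j * (g j (v $ j) - g j (v' $ j)))"
  define B where "B = (\<lambda>j. Lf j * (\<Sum>i\<in>UNIV. \<bar>b i j\<bar>))"
  have P: "norm1 P \<le> (\<Sum>j\<in>UNIV. B j * \<bar>(u - u') $ j\<bar>)"
    unfolding P_def B_def by (rule norm1_lipschitz_coupling[OF f])
  have "norm1 Q \<le> (\<Sum>j\<in>UNIV. (Lg j * (\<Sum>i\<in>UNIV. \<bar>c i j\<bar>)) * \<bar>(v - v') $ j\<bar>)"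
    unfolding Q_def by (rule norm1_lipschitz_coupling[OF g])
  also have "\<dots> \<le> k2 * norm1 (v - v')" by (rule weighted_sum_le_norm1[OF k2])
  finally have Q: "norm1 Q \<le> k2 * norm1 (v - v')" .
  have D: "D $ i = - a i * (u - u') $ i + (P + Q) $ i" for i
    by (simp add: D_def P_def Q_def network_rhs_def right_diff_distrib sum_subtractf)
  show ?thesis
  proof (intro exI[of _ "P + Q"] conjI allI D)
    have "norm1 P \<le> \<mu> * norm1 (u - u')"
      by (rule order_trans[OF P weighted_sum_le_norm1]) (simp add: B_def mu)
    thus "norm1 (P + Q) \<le> \<mu> * norm1 (u - u') + k2 * norm1 (v - v')"
      using norm1_triangle[of P Q] Q by linarith
    define E :: "real ^ 'm" where "E = (\<chi> i. - a i * (u - u') $ i)"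
    have "norm1 E = (\<Sum>j\<in>UNIV. a j * \<bar>(u - u') $ j\<bar>)"
      using a by (simp add: E_def norm1_def abs_mult)
    hence "norm1 E + norm1 P \<le> (\<Sum>j\<in>UNIV. (a j + B j) * \<bar>(u - u') $ j\<bar>)"
      using P by (simp add: sum.distrib distrib_right)
    also have "\<dots> \<le> k1 * norm1 (u - u')"
      by (rule weighted_sum_le_norm1) (use k1 in \<open>simp add: B_def\<close>)
    finally have "norm1 E + norm1 P \<le> k1 * norm1 (u - u')" .
    moreover have "D = E + (P + Q)" by (simp add: vec_eq_iff D E_def)
    ultimately show "norm1 D \<le> k1 * norm1 (u - u') + k2 * norm1 (v - v')"
      using norm1_triangle[of E "P + Q"] norm1_triangle[of P Q] Q by simp
  qed
qed

section \<open>Stability\<close>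

lemma globally_asymptotically_stable_if_exponential:
  assumes "C > 0" "\<eta> > 0"
    and bound: "\<And>t0 z t. 0 \<le> t0 \<Longrightarrow> sol t0 z \<Longrightarrow> t0 \<le> t \<Longrightarrow>
      norm1 (z t - zs t) \<le> C * exp (- \<eta> * (t - t0)) * norm1 (z t0 - zs t0)"
  shows "globally_asymptotically_stable sol zs"
  unfolding globally_asymptotically_stable_def
proof (intro allI impI conjI)
  fix t0 \<epsilon> :: real assume "0 \<le> t0" "0 < \<epsilon>"
  show "\<exists>\<delta>>0. \<forall>z. sol t0 z \<and> norm1 (z t0 - zs t0) < \<delta> \<longrightarrow> (\<forall>t\<ge>t0. norm1 (z t - zs t) < \<epsilon>)"
  proof (intro exI[of _ "\<epsilon> / C"] conjI allI impI)
    show "0 < \<epsilon> / C" using \<open>0 < \<epsilon>\<close> \<open>C > 0\<close> by simp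
    fix z t assume z: "sol t0 z \<and> norm1 (z t0 - zs t0) < \<epsilon> / C" and "t0 \<le> t"
    have "norm1 (z t - zs t) \<le> C * exp (- \<eta> * (t - t0)) * norm1 (z t0 - zs t0)"
      using bound \<open>0 \<le> t0\<close> z \<open>t0 \<le> t\<close> by blast
    also have "\<dots> \<le> C * 1 * norm1 (z t0 - zs t0)"
      using \<open>C > 0\<close> \<open>\<eta> > 0\<close> \<open>t0 \<le> t\<close> by (intro mult_right_mono mult_left_mono norm1_nonneg) auto
    also have "\<dots> < \<epsilon>" using z \<open>C > 0\<close> by (simp add: field_simps)
    finally show "norm1 (z t - zs t) < \<epsilon>" .
  qed
next
  fix t0 z assume "(0::real) \<le> t0" "sol t0 z"
  have "((\<lambda>t. C * exp (- \<eta> * (t - t0)) * norm1 (z t0 - zs t0)) \<longlongrightarrow> C * 0 * norm1 (z t0 - zs t0)) at_top"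
  proof (intro tendsto_intros filterlim_compose[OF exp_at_bot])
    have "filterlim (\<lambda>t. - t0 + t) at_top at_top"
      by (rule filterlim_tendsto_add_at_top[OF tendsto_const filterlim_ident])
    hence "filterlim (\<lambda>t. - \<eta> * (- t0 + t)) at_bot at_top"
      by (intro filterlim_tendsto_neg_mult_at_bot[OF tendsto_const]) (use \<open>\<eta> > 0\<close> in auto)
    thus "filterlim (\<lambda>t. - \<eta> * (t - t0)) at_bot at_top" by simp
  qed
  hence "((\<lambda>t. C * exp (- \<eta> * (t - t0)) * norm1 (z t0 - zs t0)) \<longlongrightarrow> 0) at_top" by simp
  moreover have "\<forall>\<^sub>F t in at_top. 0 \<le> norm1 (z t - zs t)"
    by (simp add: norm1_nonneg)
  moreover have "\<forall>\<^sub>F t in at_top. norm1 (z t - zs t) \<le> C * exp (- \<eta> * (t - t0)) * norm1 (z t0 - zs t0)"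
    unfolding eventually_at_top_linorder
    by (intro exI[of _ t0] allI impI) (rule bound[OF \<open>0 \<le> t0\<close> \<open>sol t0 z\<close>])
  ultimately show "((\<lambda>t. norm1 (z t - zs t)) \<longlongrightarrow> 0) at_top"
    by (rule tendsto_sandwich[OF _ _ tendsto_const, rotated 2])
qed

text \<open>
  Impulses with minimal distance \<open>\<delta>\<close> act on average like an exponential growth of rate
  \<open>ln (1 + l) / \<delta>\<close>.
\<close>

lemma power_impulses_le_exp:
  assumes "real n \<le> 1 + h / \<delta>" "l > 0"
  shows "(1 + l) ^ n \<le> (1 + l) * exp (ln (1 + l) / \<delta> * h)"
proof -
  have "(1 + l) ^ n = exp (real n * ln (1 + l))"
    using \<open>l > 0\<close> by (simp add: exp_of_nat_mult)
  also have "\<dots> \<le> exp ((1 + h / \<delta>) * ln (1 + l))"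
    using assms by (simp add: mult_right_mono)
  also have "(1 + h / \<delta>) * ln (1 + l) = ln (1 + l) + ln (1 + l) / \<delta> * h"
    by (simp add: algebra_simps)
  also have "exp \<dots> = (1 + l) * exp (ln (1 + l) / \<delta> * h)"
    using \<open>l > 0\<close> by (simp add: exp_add)
  finally show ?thesis .
qed

theorem theorem4p2:
  fixes a d :: "'m::finite \<Rightarrow> real"
    and b c :: "'m \<Rightarrow> 'm \<Rightarrow> real"
    and f g :: "'m \<Rightarrow> real \<Rightarrow> real"
    and I :: "'m \<Rightarrow> nat \<Rightarrow> real \<Rightarrow> real"
    and \<theta> \<tau> :: "nat \<Rightarrow> real"
    and \<theta>_sup \<tau>_inf :: real
    and Lf Lg :: "'m \<Rightarrow> real"
    and l k1 k2 \<mu> \<gamma> lam \<omega> R :: real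
    and p q p1 :: nat
    and zs :: "real \<Rightarrow> real ^ 'm"
  assumes theta0: "\<theta> 0 = 0"
    and theta_mono: "strict_mono \<theta>"
    and theta_lim: "filterlim \<theta> at_top sequentially"
    and tau_mono: "strict_mono \<tau>"
    and tau_lim: "filterlim \<tau> at_top sequentially"
    and disjoint: "range \<tau> \<inter> range \<theta> = {}"
    and theta_sup_pos: "\<theta>_sup > 0"
    and theta_sup: "\<And>k. \<theta> (Suc k) - \<theta> k \<le> \<theta>_sup"
    and tau_inf_pos: "\<tau>_inf > 0"
    and tau_inf: "\<And>k. \<tau>_inf \<le> \<tau> (Suc k) - \<tau> k"
    and p_finite: "bdd_above (range (\<lambda>k. card (range \<tau> \<inter> {\<theta> k <..< \<theta> (Suc k)})))"
    and p_def: "p = (MAX k. card (range \<tau> \<inter> {\<theta> k <..< \<theta> (Suc k)}))"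
    and a_pos: "\<And>i. a i > 0"
    and k1_def: "k1 = (MAX i. a i + Lf i * (\<Sum>j\<in>UNIV. \<bar>b j i\<bar>))"
    and k2_def: "k2 = (MAX i. Lg i * (\<Sum>j\<in>UNIV. \<bar>c j i\<bar>))"
    and mu_def: "\<mu> = (MAX i. Lf i * (\<Sum>j\<in>UNIV. \<bar>b j i\<bar>))"
    and gamma_def: "\<gamma> = (MIN i. a i)"
    and lam_def: "lam = inverse (1 - (k2 * \<theta>_sup
                     + (k1 * \<theta>_sup + l * real p) * (1 + k2 * \<theta>_sup) * (1 + l) ^ p * exp (k1 * \<theta>_sup)))"
    and Lf_pos: "\<And>j. Lf j > 0"
    and Lg_pos: "\<And>j. Lg j > 0"
    and f_lipschitz: "\<And>j u v. \<bar>f j u - f j v\<bar> \<le> Lf j * \<bar>u - v\<bar>"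
    and g_lipschitz: "\<And>j u v. \<bar>g j u - g j v\<bar> \<le> Lg j * \<bar>u - v\<bar>"
    and l_pos: "l > 0"
    and I_lipschitz: "\<And>i k u v. \<bar>I i k u - I i k v\<bar> \<le> l * \<bar>u - v\<bar>"
    and cond_iii: "((k1 + 2 * k2) * \<theta>_sup + l * real p) * (1 + l) ^ p * exp (k1 * \<theta>_sup) < 1"
    and cond_iv: "k2 * \<theta>_sup
                    + (k1 * \<theta>_sup + l * real p) * (1 + k2 * \<theta>_sup) * (1 + l) ^ p * exp (k1 * \<theta>_sup) < 1"
    and cond_v: "\<gamma> - \<mu> - lam * k2 - ln (1 + l) / \<tau>_inf > 0"
    and omega_pos: "\<omega> > 0"
    and q_pos: "q > 0"
    and p1_pos: "p1 > 0"
    and tau_periodic: "\<And>k. \<tau> (k + q) = \<tau> k + \<omega>"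
    and theta_periodic: "\<And>k. \<theta> (k + p1) = \<theta> k + \<omega>"
    and I_periodic: "\<And>i k. I i (k + q) = I i k"
    and q_count: "card (range \<tau> \<inter> {0..\<omega>}) = q"
    and R_def: "R = 1 / (1 - exp (- \<gamma> * \<omega>))"
    and cond_vii: "R * (\<omega> * (\<mu> + lam * k2) + l * real q) < 1"
    and zs_solution: "network_solution a b c d f g I \<tau> \<theta> 0 zs"
    and zs_periodic: "periodic_from_0 \<omega> zs"
  shows "globally_asymptotically_stable (network_solution a b c d f g I \<tau> \<theta>) zs"
proof (rule globally_asymptotically_stable_if_exponential)
  have k1: "a i + Lf i * (\<Sum>j\<in>UNIV. \<bar>b j i\<bar>) \<le> k1"
    and k2: "Lg i * (\<Sum>j\<in>UNIV. \<bar>c j i\<bar>) \<le> k2"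
    and mu: "Lf i * (\<Sum>j\<in>UNIV. \<bar>b j i\<bar>) \<le> \<mu>"
    and gamma: "\<gamma> \<le> a i" for i
    unfolding k1_def k2_def mu_def gamma_def
    by (rule Max_ge[OF finite_imageI[OF finite] rangeI] Min_le[OF finite_imageI[OF finite] rangeI])+
  have "0 \<le> Lf i * (\<Sum>j\<in>UNIV. \<bar>b j i\<bar>)" for i
    by (intro mult_nonneg_nonneg sum_nonneg abs_ge_zero less_imp_le[OF Lf_pos])
  hence "0 \<le> a i + Lf i * (\<Sum>j\<in>UNIV. \<bar>b j i\<bar>)" for i
    by (intro add_nonneg_nonneg less_imp_le[OF a_pos])
  hence "k1 \<ge> 0" using k1 by (rule order_trans)
  have "0 \<le> Lg i * (\<Sum>j\<in>UNIV. \<bar>c j i\<bar>)" for i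
    by (intro mult_nonneg_nonneg sum_nonneg abs_ge_zero less_imp_le[OF Lg_pos])
  hence "k2 \<ge> 0" using k2 by (rule order_trans)
  define H where "H = 1 - (k2 * \<theta>_sup
      + (k1 * \<theta>_sup + l * real p) * (1 + k2 * \<theta>_sup) * (1 + l) ^ p * exp (k1 * \<theta>_sup))"
  have "H > 0" "lam = inverse H" using cond_iv by (simp_all add: H_def lam_def)
  have fin: "finite (range \<tau> \<inter> {..t})" for t
    by (rule finite_range_atMost[OF tau_lim])
  have impulses_p: "impulses (range \<tau>) (\<theta> k) t \<le> p" if "t < \<theta> (Suc k)" for k t
  proof -
    have "impulses (range \<tau>) (\<theta> k) t \<le> card (range \<tau> \<inter> {\<theta> k<..<\<theta> (Suc k)})"
      unfolding impulses_def
      by (rule card_mono) (use that in \<open>auto intro: finite_subset[OF _ fin[of "\<theta> (Suc k)"]]\<close>)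
    also have "\<dots> \<le> p" unfolding p_def
      using p_finite by (intro Max_ge) (auto simp: bdd_above_nat)
    finally show ?thesis .
  qed
  have f_cont: "isCont (f j) v" for j v
  proof -
    have "(Lf j)-lipschitz_on UNIV (f j)"
      using f_lipschitz Lf_pos[of j] by (auto simp: lipschitz_on_def dist_real_def)
    hence "continuous_on UNIV (f j)" by (rule lipschitz_on_continuous_on)
    thus ?thesis by (simp add: continuous_on_eq_continuous_at)
  qed
  show "1 + l > 0" using l_pos by simp
  show "\<gamma> - \<mu> - lam * k2 - ln (1 + l) / \<tau>_inf > 0" by (rule cond_v)
  fix t0 t :: real and z
  assume "0 \<le> t0" and z: "network_solution a b c d f g I \<tau> \<theta> t0 z" and "t0 \<le> t"
  define y where "y = (\<lambda>t. z t - zs t)"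
  define \<beta> where "\<beta> = piecewise_arg \<theta>"
  have interval: "\<exists>k. \<theta> k \<le> s \<and> s < \<theta> (Suc k) \<and> \<beta> s = \<theta> k" if "0 \<le> s" for s
  proof -
    have "\<theta> 0 \<le> s" using that theta0 by simp
    thus ?thesis unfolding \<beta>_def by (rule piecewise_arg_interval[OF theta_mono theta_lim]) blast
  qed
  obtain k0 where k0: "\<theta> k0 \<le> t0" "t0 < \<theta> (Suc k0)" "\<beta> t0 = \<theta> k0"
    using interval[OF \<open>0 \<le> t0\<close>] by blast
  have theta_nonneg: "0 \<le> \<theta> k" for k
    using strict_mono_less_eq[OF theta_mono, of 0 k] theta0 by simp
  have beta0: "piecewise_arg \<theta> 0 = 0"
    using piecewise_arg_eq[OF theta_mono, of 0 0] theta0 strict_monoD[OF theta_mono, of 0 1] by simp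
  have deriv: "\<exists>D v. (y has_vector_derivative D) (at_right s) \<and>
      (\<forall>i. D $ i = - a i * y s $ i + v $ i) \<and>
      norm1 v \<le> \<mu> * norm1 (y s) + k2 * norm1 (y (\<beta> s)) \<and>
      norm1 D \<le> k1 * norm1 (y s) + k2 * norm1 (y (\<beta> s))" if s: "\<beta> t0 \<le> s" for s
  proof -
    have "0 \<le> s" using s k0(3) theta_nonneg[of k0] by simp
    define D where "D = network_rhs a b c d f g (z s) (z (\<beta> s)) - network_rhs a b c d f g (zs s) (zs (\<beta> s))"
    have "(z has_vector_derivative network_rhs a b c d f g (z s) (z (\<beta> s))) (at_right s)"
      using network_solution_right_derivative[OF theta_mono theta_lim theta0 tau_lim f_cont z, of s]
        s \<open>0 \<le> s\<close> by (simp add: \<beta>_def)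
    moreover have "(zs has_vector_derivative network_rhs a b c d f g (zs s) (zs (\<beta> s))) (at_right s)"
      using network_solution_right_derivative[OF theta_mono theta_lim theta0 tau_lim f_cont zs_solution, of s]
        beta0 \<open>0 \<le> s\<close> by (simp add: \<beta>_def)
    ultimately have "(y has_vector_derivative D) (at_right s)"
      unfolding y_def D_def by (rule has_vector_derivative_diff)
    moreover have "\<exists>v. (\<forall>i. D $ i = - a i * (z s - zs s) $ i + v $ i) \<and>
        norm1 v \<le> \<mu> * norm1 (z s - zs s) + k2 * norm1 (z (\<beta> s) - zs (\<beta> s)) \<and>
        norm1 D \<le> k1 * norm1 (z s - zs s) + k2 * norm1 (z (\<beta> s) - zs (\<beta> s))"
      unfolding D_def
      by (rule network_rhs_difference) (rule f_lipschitz g_lipschitz less_imp_le[OF a_pos] k1 k2 mu)+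
    ultimately show ?thesis unfolding y_def by blast
  qed
  have cont: "(y \<longlongrightarrow> y s) (at_left s)" if "\<beta> t0 < s" "s \<notin> range \<tau>" for s
    using network_solutions_difference(1)[OF z zs_solution I_lipschitz _ _ that(2)]
      that(1) beta0 k0(3) theta_nonneg[of k0] by (simp add: y_def \<beta>_def)
  have jump: "\<exists>L. (y \<longlongrightarrow> L) (at_left s) \<and> norm1 (y s - L) \<le> l * norm1 L"
    if "\<beta> t0 < s" "s \<in> range \<tau>" for s
    using network_solutions_difference(2)[OF z zs_solution I_lipschitz _ _ that(2)]
      that(1) beta0 k0(3) theta_nonneg[of k0] by (simp add: y_def \<beta>_def)
  have delayed: "norm1 (y (\<beta> s)) \<le> lam * norm1 (y s)" if s: "\<beta> t0 \<le> s" for s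
  proof -
    have "0 \<le> s" using s k0(3) theta_nonneg[of k0] by simp
    then obtain k where k: "\<theta> k \<le> s" "s < \<theta> (Suc k)" "\<beta> s = \<theta> k" using interval by blast
    \<comment> \<open>The interval of \<open>\<theta>\<close> that contains \<open>s\<close> does not begin before \<open>\<beta> t0\<close>, so both
      solutions obey the equation on all of it.\<close>
    have "\<theta> k0 < \<theta> (Suc k)" using k s k0(3) by linarith
    hence "k0 \<le> k" using strict_mono_less[OF theta_mono] by auto
    hence start: "\<beta> t0 \<le> \<theta> k" using strict_mono_less_eq[OF theta_mono] k0(3) by simp
    have "H * norm1 (y (\<theta> k)) \<le> norm1 (y s)" unfolding H_def
    proof (rule norm1_at_delayed_argument_le[OF \<open>\<theta> k \<le> s\<close> _ fin])
      show "s - \<theta> k \<le> \<theta>_sup" using theta_sup[of k] k by linarith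
      show "impulses (range \<tau>) (\<theta> k) s \<le> p" by (rule impulses_p[OF k(2)])
    next
      fix u assume u: "\<theta> k \<le> u" "u < s"
      hence "\<beta> u = \<theta> k" unfolding \<beta>_def using k by (intro piecewise_arg_eq[OF theta_mono]) auto
      thus "\<exists>D. (y has_vector_derivative D) (at_right u) \<and>
          norm1 D \<le> k1 * norm1 (y u) + k2 * norm1 (y (\<theta> k))"
        using deriv[of u] u start by auto
    next
      fix u assume "\<theta> k < u" "u \<le> s" "u \<notin> range \<tau>"
      thus "(y \<longlongrightarrow> y u) (at_left u)" using start by (intro cont) auto
    next
      fix u assume "\<theta> k < u" "u \<le> s" "u \<in> range \<tau>"
      thus "\<exists>L. (y \<longlongrightarrow> L) (at_left u) \<and> norm1 (y u - L) \<le> l * norm1 L"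
        using start by (intro jump) auto
    qed (use \<open>k1 \<ge> 0\<close> \<open>k2 \<ge> 0\<close> l_pos in auto)
    hence "lam * (H * norm1 (y (\<theta> k))) \<le> lam * norm1 (y s)"
      using \<open>H > 0\<close> \<open>lam = inverse H\<close> by (intro mult_left_mono) auto
    moreover have "lam * (H * norm1 (y (\<theta> k))) = norm1 (y (\<beta> s))"
      using \<open>H > 0\<close> \<open>lam = inverse H\<close> k(3) by simp
    ultimately show ?thesis by simp
  qed
  have "norm1 (y t) \<le> (1 + l) ^ impulses (range \<tau>) t0 t
      * exp (- (\<gamma> - (\<mu> + lam * k2)) * (t - t0)) * norm1 (y t0)"
  proof (rule damped_impulsive_decay[OF \<open>t0 \<le> t\<close> fin _ gamma])
    fix s assume "t0 \<le> s" "s < t"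
    hence s: "\<beta> t0 \<le> s" using k0 by simp
    obtain D v where "(y has_vector_derivative D) (at_right s)"
      "\<forall>i. D $ i = - a i * y s $ i + v $ i"
      and v: "norm1 v \<le> \<mu> * norm1 (y s) + k2 * norm1 (y (\<beta> s))"
      using deriv[OF s] by blast
    moreover have "norm1 v \<le> (\<mu> + lam * k2) * norm1 (y s)"
      using v mult_left_mono[OF delayed[OF s] \<open>k2 \<ge> 0\<close>] by (simp add: algebra_simps)
    ultimately show "\<exists>D v. (y has_vector_derivative D) (at_right s) \<and>
        (\<forall>i. D $ i = - a i * y s $ i + v $ i) \<and> norm1 v \<le> (\<mu> + lam * k2) * norm1 (y s)"
      by blast
  next
    fix s assume "t0 < s" "s \<le> t" "s \<notin> range \<tau>"
    thus "(y \<longlongrightarrow> y s) (at_left s)" using k0 by (intro cont) auto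
  next
    fix s assume "t0 < s" "s \<le> t" "s \<in> range \<tau>"
    thus "\<exists>L. (y \<longlongrightarrow> L) (at_left s) \<and> norm1 (y s - L) \<le> l * norm1 L"
      using k0 by (intro jump) auto
  qed (use l_pos in auto)
  also have "\<dots> \<le> (1 + l) * exp (ln (1 + l) / \<tau>_inf * (t - t0))
      * exp (- (\<gamma> - (\<mu> + lam * k2)) * (t - t0)) * norm1 (y t0)"
    using power_impulses_le_exp[OF impulses_le_separated[OF tau_lim tau_inf tau_inf_pos \<open>t0 \<le> t\<close>] l_pos]
    by (intro mult_right_mono norm1_nonneg) auto
  also have "\<dots> = (1 + l) * exp (- (\<gamma> - \<mu> - lam * k2 - ln (1 + l) / \<tau>_inf) * (t - t0)) * norm1 (y t0)"
    by (simp add: mult.assoc exp_add[symmetric] algebra_simps)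
  finally show "norm1 (z t - zs t) \<le> (1 + l)
      * exp (- (\<gamma> - \<mu> - lam * k2 - ln (1 + l) / \<tau>_inf) * (t - t0)) * norm1 (z t0 - zs t0)"
    by (simp add: y_def)
qed

end
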